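(* Let $C$ and $d$ be constants and let $f$ be a $C$-nearly-isotropic log-concave density on $\mathbb{R}^d$. Then for a tail bound function $g(t)=e^{-\Omega(t)}$ there is a constant $c_1=O_{C,d}(1)$ such that $f\in\mathcal{C}_{\mathrm{SI}}(c_1,d,g)$.
   Context: A density is log-concave if it equals $e^\phi$ for an upper semi-continuous concave $\phi$. A distribution on $\mathbb{R}^d$ is $C$-nearly-isotropic if its covariance matrix $\Sigma$ satisfies $\frac1C\le \frac{x^T\Sigma x}{x^Tx}\le C$ for all $x\ne0$. For a density $f$, unit vector $v$ and $\kappa>0$, $\mathrm{SI}(f,v,\kappa)=\frac1\kappa\sup_{\kappa'\in[0,\kappa]}\int|f(x+\kappa'v)-f(x)|\,dx$ and $\mathrm{SI}(f,\kappa)=\sup_{\|v\|_2=1}\mathrm{SI}(f,v,\kappa)$. $\mathcal{C}_{\mathrm{SI}}(c,d)$ is the class of densities on $\mathbb{R}^d$ with $\mathrm{SI}(f,\kappa)\le c$ for all $\kappa>0$; for a nonincreasing $g:\mathbb{R}^+\to[0,1]$ with $g(t)\to0$, $\mathcal{C}_{\mathrm{SI}}(c,d,g)$ is the set of $f\in\mathcal{C}_{\mathrm{SI}}(c,d)$ with $\Pr_{x\sim f}[\|x-\mu\|>t]\le g(t)$ for all $t>0$, $\mu$ the mean of $f$. The constants hidden in $\Omega(\cdot)$ and $O_{C,d}(\cdot)$ may depend on $C,d$. *)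

theory Defs
  imports "HOL-Analysis.Analysis"
begin

definition is_density :: "(real^'n \<Rightarrow> real) \<Rightarrow> bool" where
  "is_density f \<longleftrightarrow> f \<in> borel_measurable lebesgue \<and> (\<forall>x. 0 \<le> f x)
     \<and> integrable lebesgue f \<and> integral\<^sup>L lebesgue f = 1"

definition ereal_concave :: "(real^'n \<Rightarrow> ereal) \<Rightarrow> bool" where
  "ereal_concave \<phi> \<longleftrightarrow> (\<forall>x y (t::real). 0 \<le> t \<and> t \<le> 1 \<longrightarrow>
      ereal (1 - t) * \<phi> x + ereal t * \<phi> y \<le> \<phi> ((1 - t) *\<^sub>R x + t *\<^sub>R y))"

definition ereal_usc :: "(real^'n \<Rightarrow> ereal) \<Rightarrow> bool" where
  "ereal_usc \<phi> \<longleftrightarrow> (\<forall>x. Limsup (at x) \<phi> \<le> \<phi> x)"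

definition log_concave :: "(real^'n \<Rightarrow> real) \<Rightarrow> bool" where
  "log_concave f \<longleftrightarrow> (\<exists>\<phi> :: real^'n \<Rightarrow> ereal.
      (\<forall>x. \<phi> x < \<infinity>) \<and> ereal_concave \<phi> \<and> ereal_usc \<phi> \<and>
      (\<forall>x. f x = (if \<phi> x = -\<infinity> then 0 else exp (real_of_ereal (\<phi> x)))))"

definition density_mean :: "(real^'n \<Rightarrow> real) \<Rightarrow> real^'n" where
  "density_mean f = (\<chi> i. integral\<^sup>L lebesgue (\<lambda>x. f x * x $ i))"

definition covariance_matrix :: "(real^'n \<Rightarrow> real) \<Rightarrow> real^'n^'n" where
  "covariance_matrix f = (\<chi> i j. integral\<^sup>L lebesgue
      (\<lambda>x. f x * ((x $ i - density_mean f $ i) * (x $ j - density_mean f $ j))))"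

definition nearly_isotropic :: "real \<Rightarrow> (real^'n \<Rightarrow> real) \<Rightarrow> bool" where
  "nearly_isotropic C f \<longleftrightarrow>
     (\<forall>i. integrable lebesgue (\<lambda>x. f x * (x $ i)\<^sup>2)) \<and>
     (\<forall>x::real^'n. x \<noteq> 0 \<longrightarrow>
        1 / C \<le> (x \<bullet> (covariance_matrix f *v x)) / (x \<bullet> x) \<and>
        (x \<bullet> (covariance_matrix f *v x)) / (x \<bullet> x) \<le> C)"

definition SI_dir :: "(real^'n \<Rightarrow> real) \<Rightarrow> real^'n \<Rightarrow> real \<Rightarrow> ereal" where
  "SI_dir f v \<kappa> = ereal (1 / \<kappa>) *
     (SUP \<kappa>'\<in>{0..\<kappa>}. ereal (integral\<^sup>L lebesgue (\<lambda>x. \<bar>f (x + \<kappa>' *\<^sub>R v) - f x\<bar>)))"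

definition SI :: "(real^'n \<Rightarrow> real) \<Rightarrow> real \<Rightarrow> ereal" where
  "SI f \<kappa> = (SUP v\<in>{v. norm v = 1}. SI_dir f v \<kappa>)"

definition C_SI :: "real \<Rightarrow> (real^'n \<Rightarrow> real) set" where
  "C_SI c = {f. is_density f \<and> (\<forall>\<kappa>>0. SI f \<kappa> \<le> ereal c)}"

definition tail_function :: "(real \<Rightarrow> real) \<Rightarrow> bool" where
  "tail_function g \<longleftrightarrow> antimono_on {0<..} g \<and> (\<forall>t>0. 0 \<le> g t \<and> g t \<le> 1)
     \<and> (g \<longlongrightarrow> 0) at_top"

definition C_SI_tail :: "real \<Rightarrow> (real \<Rightarrow> real) \<Rightarrow> (real^'n \<Rightarrow> real) set" where
  "C_SI_tail c g = {f. f \<in> C_SI c \<and>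
     (\<forall>t>0. (LINT x:{x. norm (x - density_mean f) > t}|lebesgue. f x) \<le> g t)}"

end

theory Submission
  imports Defs
begin

text \<open>
  The crux is a ball of radius \<open>r\<close> around the mean on which \<open>f \<ge> m\<close>, with \<open>r\<close> and \<open>m\<close>
  depending on \<open>C\<close> and \<open>d\<close> only. If \<open>f q < m\<close>, then \<open>f < m\<close> on a half-space whose boundary
  contains \<open>q\<close>, because superlevel sets are convex. By Chebyshev such a half-space has small mass
  when \<open>m\<close> is small. On the other hand its mass is bounded below for \<open>q\<close> near the mean, once the
  first absolute moments of the one-dimensional projections are bounded below. The latter is
  obtained from the second moments by comparing \<open>f\<close> with its contractions by the factor \<open>1/2\<close>
  towards a suitable point.

  Given the ball, contracting it towards \<open>x\<close> bounds \<open>f x\<close> by some \<open>M\<close>. Contracting \<open>x\<close> towards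
  the ball with ratio \<open>\<lambda> = \<kappa> / r\<close> gives
  \<open>(m / M) powr \<lambda> * f x \<le> f ((1 - \<lambda>) *\<^sub>R x + \<lambda> *\<^sub>R p + \<kappa> *\<^sub>R u)\<close> for all \<open>norm u \<le> 1\<close>, so \<open>f\<close> and its
  translate by \<open>\<kappa> *\<^sub>R v\<close> have a common minorant of mass \<open>(m / M) powr \<lambda> * (1 - \<lambda>) ^ d\<close>; hence their
  \<open>L\<^sup>1\<close> distance is \<open>O(\<kappa>)\<close>. Chebyshev and the ball give \<open>f < m / e\<close> outside a ball of some
  radius \<open>\<rho>\<close> around the mean, and dilating by \<open>s \<ge> 1\<close> turns this into the tail bound
  \<open>s ^ d * exp (1 - s)\<close> at distance \<open>s * \<rho>\<close>.
\<close>

section \<open>Integrals under affine maps and over balls\<close>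

lemma affine_substitution:
  fixes g :: "'a::euclidean_space \<Rightarrow> real"
  assumes g: "integrable lebesgue g" and c: "c \<noteq> 0"
  shows integrable_affine: "integrable lebesgue (\<lambda>x. g (t + c *\<^sub>R x))"
    and integral_affine: "integral\<^sup>L lebesgue g = \<bar>c\<bar> ^ DIM('a) * integral\<^sup>L lebesgue (\<lambda>x. g (t + c *\<^sub>R x))"
proof -
  define h where "h = (\<lambda>x::'a. t + c *\<^sub>R x)"
  \<comment> \<open>In coordinates \<open>h\<close> is a diagonal affine map with all scale factors
    equal to \<open>c\<close>, hence the Jacobian \<open>\<bar>c\<bar> ^ DIM('a)\<close>.\<close>
  have h_eq: "h = (\<lambda>x. t + (\<Sum>j\<in>Basis. (c * (x \<bullet> j)) *\<^sub>R j))"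
    by (simp add: h_def fun_eq_iff flip: scaleR_scaleR scaleR_sum_right) (simp add: euclidean_representation)
  have h[measurable]: "h \<in> lebesgue \<rightarrow>\<^sub>M lebesgue"
    unfolding h_eq by (rule lebesgue_affine_measurable) (use c in auto)
  have leb: "lebesgue = density (distr lebesgue lebesgue h) (\<lambda>_. ennreal (\<bar>c\<bar> ^ DIM('a)))"
    unfolding h_eq using lebesgue_affine_euclidean[of "\<lambda>_. c" t] c by (simp add: ennreal_power)
  have [measurable]: "g \<in> borel_measurable lebesgue"
    using g by auto
  have "integrable (density (distr lebesgue lebesgue h) (\<lambda>_. ennreal (\<bar>c\<bar> ^ DIM('a)))) g"
    using g leb by metis
  then have "integrable lebesgue (\<lambda>x. g (h x))"
    using c by (subst (asm) integrable_density) (auto simp: integrable_distr_eq[OF h])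
  then show "integrable lebesgue (\<lambda>x. g (t + c *\<^sub>R x))"
    by (simp add: h_def)
  have "integral\<^sup>L lebesgue g = integral\<^sup>L (density (distr lebesgue lebesgue h) (\<lambda>_. ennreal (\<bar>c\<bar> ^ DIM('a)))) g"
    using leb by metis
  also have "\<dots> = \<bar>c\<bar> ^ DIM('a) * integral\<^sup>L lebesgue (\<lambda>x. g (h x))"
    by (subst integral_density) (auto simp: integral_distr[OF h])
  finally show "integral\<^sup>L lebesgue g = \<bar>c\<bar> ^ DIM('a) * integral\<^sup>L lebesgue (\<lambda>x. g (t + c *\<^sub>R x))"
    by (simp add: h_def)
qed

lemma ball_mass_le_integral:
  fixes h :: "'a::euclidean_space \<Rightarrow> real"
  assumes h: "integrable lebesgue h" and nonneg: "\<And>x. 0 \<le> h x"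
    and ge: "\<And>x. x \<in> cball p r \<Longrightarrow> a \<le> h x"
  shows "a * measure lborel (cball p r) \<le> integral\<^sup>L lebesgue h"
proof -
  have "integrable lebesgue (indicator (cball p r) :: 'a \<Rightarrow> real)"
    using emeasure_lborel_cball_finite[of p r] by (intro integrable_real_indicator) auto
  then have i: "integrable lebesgue (\<lambda>x. a * indicator (cball p r) x)"
    by simp
  have "integral\<^sup>L lebesgue (\<lambda>x. a * indicator (cball p r) x) \<le> integral\<^sup>L lebesgue h"
    by (rule integral_mono[OF i h])
       (use nonneg ge in \<open>auto simp: indicator_def\<close>)
  then show ?thesis
    by simp
qed

section \<open>Log-concave densities: superlevel sets and boundedness\<close>

locale log_concave_density =
  fixes f :: "'a::euclidean_space \<Rightarrow> real"
  assumes meas[measurable]: "f \<in> borel_measurable lebesgue"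
    and nonneg: "\<And>x. 0 \<le> f x"
    and integ: "integrable lebesgue f"
    and total: "integral\<^sup>L lebesgue f = 1"
    and lc: "\<And>x y t. 0 \<le> t \<Longrightarrow> t \<le> 1 \<Longrightarrow>
      f x powr (1 - t) * f y powr t \<le> f ((1 - t) *\<^sub>R x + t *\<^sub>R y)"
begin

lemma midpoint: "f x * f y \<le> (f ((1/2) *\<^sub>R x + (1/2) *\<^sub>R y))\<^sup>2"
proof -
  have "sqrt (f x) * sqrt (f y) \<le> f ((1/2) *\<^sub>R x + (1/2) *\<^sub>R y)"
    using lc[of "1/2" x y] by (simp add: powr_half_sqrt nonneg)
  then have "(sqrt (f x) * sqrt (f y))\<^sup>2 \<le> (f ((1/2) *\<^sub>R x + (1/2) *\<^sub>R y))\<^sup>2"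
    by (intro power_mono) (auto simp: nonneg)
  then show ?thesis
    by (simp add: power_mult_distrib nonneg)
qed

lemma convex_superlevel: "convex {x. m \<le> f x}"
proof (cases "m > 0")
  case True
  show ?thesis
  proof (rule convexI, clarsimp)
    fix u v :: real and a b
    assume ab: "m \<le> f a" "m \<le> f b" and uv: "0 \<le> u" "0 \<le> v" "u + v = 1"
    have "m = m powr u * m powr v"
      using True uv by (simp flip: powr_add)
    also have "\<dots> \<le> f a powr u * f b powr v"
      using ab uv True by (intro mult_mono powr_mono2) auto
    also have "\<dots> \<le> f (u *\<^sub>R a + v *\<^sub>R b)"
    proof -
      have v: "v = 1 - u" using uv by simp
      show ?thesis
        using lc[of "1 - u" a b] uv(1,2) unfolding v by simp
    qed
    finally show "m \<le> f (u *\<^sub>R a + v *\<^sub>R b)" .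
  qed
next
  case False
  then have "m \<le> f x" for x
    using nonneg[of x] by simp
  then have "{x. m \<le> f x} = UNIV"
    by simp
  then show ?thesis by simp
qed

text \<open>Contracting the ball by the factor 1/2 towards \<open>x\<close> gives a ball of radius
  \<open>r/2\<close> on which the midpoint inequality forces \<open>f \<ge> sqrt (f x * m)\<close>.
  Its mass is at most 1, which bounds \<open>f x\<close>.\<close>

lemma upper_bound_from_ball:
  assumes m: "m > 0" and r: "r > 0" and ge: "\<And>x. x \<in> cball p r \<Longrightarrow> m \<le> f x"
  shows "f x \<le> 1 / (m * (measure lborel (cball (0::'a) (r/2)))\<^sup>2)"
proof -
  let ?q = "(1/2) *\<^sub>R x + (1/2) *\<^sub>R p" and ?v = "measure lborel (cball (0::'a) (r/2))"
  have v: "?v > 0" using r by simp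
  have "sqrt (f x * m) \<le> f y" if y: "y \<in> cball ?q (r/2)" for y
  proof -
    let ?z = "2 *\<^sub>R y - x"
    have "?z - p = 2 *\<^sub>R (y - ?q)"
      by (simp add: algebra_simps)
    then have "norm (?z - p) \<le> r"
      using y by (simp add: dist_norm norm_minus_commute)
    then have "m \<le> f ?z"
      by (intro ge) (simp add: dist_norm norm_minus_commute)
    then have "f x * m \<le> f x * f ?z"
      by (intro mult_left_mono nonneg)
    also have "\<dots> \<le> (f y)\<^sup>2"
      using midpoint[of x ?z] by (simp add: algebra_simps)
    finally show ?thesis
      using nonneg real_le_lsqrt by blast
  qed
  then have "sqrt (f x * m) * measure lborel (cball ?q (r/2)) \<le> 1"
    using ball_mass_le_integral[OF integ nonneg, of ?q "r/2"] total by simp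
  then have "sqrt (f x * m) * ?v \<le> 1"
    using r by (simp add: content_cball)
  then have "(sqrt (f x * m) * ?v)\<^sup>2 \<le> 1\<^sup>2"
    using m v by (intro power_mono) (auto simp: nonneg)
  then have "f x * (m * ?v\<^sup>2) \<le> 1"
    using m by (simp add: power_mult_distrib nonneg mult.assoc)
  then show ?thesis
    using m v by (simp add: pos_le_divide_eq)
qed

text \<open>A convex set with empty interior is negligible, and \<open>f\<close> is not zero almost
  everywhere, so some superlevel set at a positive height contains a ball. The resulting bound is
  not uniform in \<open>f\<close>; it only serves to make \<open>Sup (range f)\<close> meaningful in
  \<open>first_moment_lower_bound\<close>, where that supremum cancels.\<close>

lemma bdd_above_range: "bdd_above (range f)"
proof -
  have "\<exists>n::nat. interior {x. 1 / (Suc n) \<le> f x} \<noteq> {}"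
  proof (rule ccontr)
    assume "\<not> ?thesis"
    then have "negligible {x. 1 / (Suc n) \<le> f x}" for n :: nat
      by (intro negligible_convex_interior[THEN iffD2] convex_superlevel) auto
    then have "negligible (\<Union>n::nat. {x. 1 / (Suc n) \<le> f x})"
      by (intro negligible_countable_Union) auto
    moreover have "{x. f x \<noteq> 0} \<subseteq> (\<Union>n::nat. {x. 1 / (Suc n) \<le> f x})"
    proof clarsimp
      fix x assume "f x \<noteq> 0"
      then have "0 < f x" using nonneg[of x] by simp
      then show "\<exists>n::nat. 1 / (1 + real n) \<le> f x"
        using reals_Archimedean[of "f x"] by (auto simp: inverse_eq_divide add.commute intro: less_imp_le)
    qed
    ultimately have "negligible {x. f x \<noteq> 0}"
      by (rule negligible_subset)
    then have "AE x in lebesgue. f x = 0"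
      by (intro AE_I'[where N="{x. f x \<noteq> 0}"]) (auto simp: negligible_iff_null_sets)
    then have "integral\<^sup>L lebesgue f = 0"
      by (rule integral_eq_zero_AE)
    then show False using total by simp
  qed
  then obtain n :: nat and p r where "r > 0" "cball p r \<subseteq> {x. 1 / (Suc n) \<le> f x}"
    by (metis ex_in_conv mem_interior_cball)
  then have "f x \<le> 1 / (1 / (Suc n) * (measure lborel (cball (0::'a) (r/2)))\<^sup>2)" for x
    by (intro upper_bound_from_ball[where p=p]) auto
  then show ?thesis
    by (intro bdd_aboveI2)
qed

lemma integrable_mult_quadratic:
  assumes int2: "integrable lebesgue (\<lambda>x. f x * (norm x)\<^sup>2)"
    and g: "g \<in> borel_measurable borel" and bound: "\<And>x. \<bar>g x\<bar> \<le> A + B * (norm x)\<^sup>2"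
  shows "integrable lebesgue (\<lambda>x. f x * g x)"
proof (rule Bochner_Integration.integrable_bound)
  show "integrable lebesgue (\<lambda>x. A * f x + B * (f x * (norm x)\<^sup>2))"
    using integ int2 by auto
  have [measurable]: "g \<in> borel_measurable lebesgue"
    using g by (intro measurable_completion) simp
  show "(\<lambda>x. f x * g x) \<in> borel_measurable lebesgue"
    by measurable
  have "f x * \<bar>g x\<bar> \<le> \<bar>A * f x + B * (f x * (norm x)\<^sup>2)\<bar>" for x
    using mult_left_mono[OF bound nonneg, of x x] by (simp add: algebra_simps)
  then show "AE x in lebesgue. norm (f x * g x) \<le> norm (A * f x + B * (f x * (norm x)\<^sup>2))"
    by (auto simp: abs_mult nonneg)
qed

end

section \<open>Moments of projections and the superlevel ball around the mean\<close>

locale log_concave_density2 = log_concave_density +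
  assumes int2: "integrable lebesgue (\<lambda>x. f x * (norm x)\<^sup>2)"
begin

lemmas integrable_quadratic = integrable_mult_quadratic[OF int2]

lemma integrable_affine_sq: "integrable lebesgue (\<lambda>x. f x * (\<theta> \<bullet> x - s)\<^sup>2)"
proof (rule integrable_quadratic[where A="2 * s\<^sup>2" and B="2 * (norm \<theta>)\<^sup>2"])
  fix x :: 'a
  have "(\<theta> \<bullet> x - s)\<^sup>2 \<le> 2 * s\<^sup>2 + 2 * (\<theta> \<bullet> x)\<^sup>2"
    using sum_squares_ge_zero[of "\<theta> \<bullet> x + s" 0] by (simp add: power2_eq_square algebra_simps)
  also have "(\<theta> \<bullet> x)\<^sup>2 \<le> (norm \<theta>)\<^sup>2 * (norm x)\<^sup>2"
    using Cauchy_Schwarz_ineq[of \<theta> x] by (simp add: power2_norm_eq_inner)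
  finally show "\<bar>(\<theta> \<bullet> x - s)\<^sup>2\<bar> \<le> 2 * s\<^sup>2 + 2 * (norm \<theta>)\<^sup>2 * (norm x)\<^sup>2"
    by simp
qed auto

lemma integrable_affine_fun:
  shows integrable_affine_lin: "integrable lebesgue (\<lambda>x. f x * (\<theta> \<bullet> x - s))"
    and integrable_affine_abs: "integrable lebesgue (\<lambda>x. f x * \<bar>\<theta> \<bullet> x - s\<bar>)"
proof -
  have *: "\<bar>\<theta> \<bullet> x - s\<bar> \<le> (1 + 2 * s\<^sup>2) + 2 * (norm \<theta>)\<^sup>2 * (norm x)\<^sup>2" for x
  proof -
    have "\<bar>u\<bar> \<le> 1 + u\<^sup>2" for u :: real
      using zero_le_power2[of "\<bar>u\<bar> - 1"] by (simp add: power2_diff)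
    then have "\<bar>\<theta> \<bullet> x - s\<bar> \<le> 1 + (\<theta> \<bullet> x - s)\<^sup>2" .
    also have "(\<theta> \<bullet> x - s)\<^sup>2 \<le> 2 * s\<^sup>2 + 2 * (\<theta> \<bullet> x)\<^sup>2"
      using sum_squares_ge_zero[of "\<theta> \<bullet> x + s" 0] by (simp add: power2_eq_square algebra_simps)
    also have "(\<theta> \<bullet> x)\<^sup>2 \<le> (norm \<theta>)\<^sup>2 * (norm x)\<^sup>2"
      using Cauchy_Schwarz_ineq[of \<theta> x] by (simp add: power2_norm_eq_inner)
    finally show ?thesis by simp
  qed
  show "integrable lebesgue (\<lambda>x. f x * (\<theta> \<bullet> x - s))" "integrable lebesgue (\<lambda>x. f x * \<bar>\<theta> \<bullet> x - s\<bar>)"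
    by (rule integrable_quadratic[where A="1 + 2 * s\<^sup>2" and B="2 * (norm \<theta>)\<^sup>2"]; use * in simp)+
qed

text \<open>For a general density a large second moment may come from very little mass far away.
  Log-concavity excludes this, with a loss that depends on the dimension only, through the Jacobian
  \<open>D\<close> of the contraction by 1/2.\<close>

lemma first_moment_lower_bound:
  assumes T: "T > 0" and big: "72 * T\<^sup>2 < integral\<^sup>L lebesgue (\<lambda>x. f x * (\<theta> \<bullet> x - s)\<^sup>2)"
  shows "T / (144 * 4 ^ DIM('a)) \<le> integral\<^sup>L lebesgue (\<lambda>x. f x * \<bar>\<theta> \<bullet> x - s\<bar>)"
proof -
  define X where "X = (\<lambda>x. \<theta> \<bullet> x - s)"
  define D where "D = (2::real) ^ DIM('a)"
  \<comment> \<open>Chosen such that \<open>18 * e * D = 1 / 2\<close>, which lets the second case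
    absorb half of \<open>E2\<close>.\<close>
  define e where "e = 1 / (36 * D)"
  define M where "M = Sup (range f)"
  define E1 where "E1 = integral\<^sup>L lebesgue (\<lambda>x. f x * \<bar>X x\<bar>)"
  define E2 where "E2 = integral\<^sup>L lebesgue (\<lambda>x. f x * (X x)\<^sup>2)"
  have D: "D \<ge> 1" by (simp add: D_def)
  have e: "0 < e" "e < 1" using D by (auto simp: e_def)
  have le_M: "f x \<le> M" for x
    unfolding M_def by (intro cSup_upper bdd_above_range) auto
  have mid: "X ((1/2) *\<^sub>R x + (1/2) *\<^sub>R y) = (X x + X y) / 2" for x y
    by (simp add: X_def inner_simps field_simps)
  have int_X: "integrable lebesgue (\<lambda>x. f x * \<bar>X x\<bar>)" "integrable lebesgue (\<lambda>x. f x * (X x)\<^sup>2)"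
    unfolding X_def by (rule integrable_affine_abs integrable_affine_sq)+
  have half: "integrable lebesgue (\<lambda>y. g ((1/2) *\<^sub>R x + (1/2) *\<^sub>R y))"
      "integral\<^sup>L lebesgue (\<lambda>y. g ((1/2) *\<^sub>R x + (1/2) *\<^sub>R y)) = D * integral\<^sup>L lebesgue g"
    if "integrable lebesgue g" for g :: "'a \<Rightarrow> real" and x
    using integrable_affine[OF that, of "1/2" "(1/2) *\<^sub>R x"]
      integral_affine[OF that, of "1/2" "(1/2) *\<^sub>R x"]
    by (auto simp: D_def power_one_over)
  have "\<exists>x. f x \<noteq> 0"
  proof (rule ccontr)
    assume "\<not> ?thesis"
    then have "f = (\<lambda>_. 0)" by auto
    then show False using total by simp
  qed
  then have M: "M > 0"
    using le_M nonneg by (metis order.not_eq_order_implies_strict order_less_le_trans)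
  then have "M / 2 < Sup (range f)"
    by (simp add: M_def)
  \<comment> \<open>Half of the supremum suffices: in the second case \<open>M < 2 * f z\<close>
    lets \<open>f z\<close> cancel.\<close>
  then obtain z where z: "M / 2 < f z"
    using less_cSup_iff[OF _ bdd_above_range, of "M / 2"] by blast
  txt \<open>Either a point of relatively large density lies far from the hyperplane, and contracting
    towards it moves mass away from the hyperplane, or \<open>f\<close> is so small far from the hyperplane that
    contracting towards \<open>z\<close> bounds the second moment.\<close>
  have "e * T / (4 * D) \<le> E1"
  proof (cases "\<exists>x. T \<le> \<bar>X x\<bar> \<and> e * M \<le> f x")
    case True
    then obtain x where x: "T \<le> \<bar>X x\<bar>" "e * M \<le> f x" by auto
    let ?m = "\<lambda>y. (1/2) *\<^sub>R x + (1/2) *\<^sub>R y"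
    \<comment> \<open>The midpoint inequality bounds \<open>f (?m y)\<close> below by the geometric
      mean of \<open>f x\<close> and \<open>f y\<close>. With \<open>f x \<ge> e * M\<close>,
      \<open>M \<ge> f y\<close> and \<open>e < 1\<close> this becomes linear in
      \<open>f y\<close>.\<close>
    have ge: "e * f y \<le> f (?m y)" for y
    proof -
      have "(e * f y)\<^sup>2 = (e * f y) * (e * f y)"
        by (simp add: power2_eq_square)
      also have "\<dots> \<le> (e * M) * (1 * f y)"
        using e M nonneg le_M by (intro mult_mono) auto
      also have "\<dots> \<le> f x * f y"
        using x nonneg by (auto intro: mult_right_mono)
      also have "\<dots> \<le> (f (?m y))\<^sup>2"
        by (rule midpoint)
      finally show ?thesis
        using nonneg by (rule power2_le_imp_le)
    qed
    \<comment> \<open>Since \<open>\<bar>X x\<bar> \<ge> T\<close>, a point \<open>y\<close> near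
      the hyperplane has a midpoint with \<open>x\<close> at which \<open>\<bar>X\<bar>\<close> is
      at least \<open>(T - \<bar>X y\<bar>) / 2\<close>. For \<open>\<bar>X y\<bar> > T\<close> the
      left-hand side is not positive.\<close>
    have pt: "(e/2) * (T * f y - f y * \<bar>X y\<bar>) \<le> f (?m y) * \<bar>X (?m y)\<bar>" for y
    proof (cases "\<bar>X y\<bar> \<le> T")
      case True
      have "(T - \<bar>X y\<bar>) / 2 \<le> \<bar>X (?m y)\<bar>"
      proof -
        have "T - \<bar>X y\<bar> \<le> \<bar>X x + X y\<bar>"
          using x(1) by linarith
        then show ?thesis
          by (simp add: mid)
      qed
      then have "e * f y * ((T - \<bar>X y\<bar>) / 2) \<le> f (?m y) * \<bar>X (?m y)\<bar>"
        using True nonneg e by (intro mult_mono ge) auto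
      then show ?thesis
        by (simp add: algebra_simps)
    next
      case False
      then have "f y * (T - \<bar>X y\<bar>) \<le> 0"
        by (intro mult_nonneg_nonpos nonneg) auto
      then have "(e/2) * (T * f y - f y * \<bar>X y\<bar>) \<le> 0"
        using e by (intro mult_nonneg_nonpos) (auto simp: algebra_simps)
      also have "0 \<le> f (?m y) * \<bar>X (?m y)\<bar>"
        using nonneg by simp
      finally show ?thesis .
    qed
    have "(e/2) * (T - E1) = integral\<^sup>L lebesgue (\<lambda>y. (e/2) * (T * f y - f y * \<bar>X y\<bar>))"
      using integ int_X total by (simp add: E1_def)
    also have "\<dots> \<le> integral\<^sup>L lebesgue (\<lambda>y. f (?m y) * \<bar>X (?m y)\<bar>)"
      by (intro integral_mono pt half(1)[OF int_X(1)]) (use integ int_X in auto)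
    also have "\<dots> = D * E1"
      unfolding E1_def by (rule half(2)[OF int_X(1)])
    finally have *: "e * T / 2 \<le> (D + e / 2) * E1"
      by (simp add: algebra_simps)
    have "E1 \<ge> 0"
      unfolding E1_def by (intro integral_nonneg_AE) (auto simp: nonneg)
    then have "(D + e / 2) * E1 \<le> (2 * D) * E1"
      using D e by (intro mult_right_mono) auto
    with * show ?thesis
      using D by (simp add: field_simps)
  next
    case False
    then have small: "f x < e * M" if "T \<le> \<bar>X x\<bar>" for x
      using that by force
    have "e * M \<le> M / 2"
      using M D by (simp add: e_def field_simps)
    then have Xz: "\<bar>X z\<bar> < T"
      using small[of z] z by linarith
    let ?m = "\<lambda>y. (1/2) *\<^sub>R z + (1/2) *\<^sub>R y"
    \<comment> \<open>If \<open>\<bar>X y\<bar> > 6 * T\<close>, the midpoint with \<open>z\<close>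
      still lies where \<open>f < e * M\<close>, so \<open>f y \<le> 2 * e * f (?m y)\<close>.
      Together with \<open>\<bar>X y\<bar> \<le> 3 * \<bar>X (?m y)\<bar>\<close> this gives the
      factor \<open>18 = 2 * 3 ^ 2\<close>.\<close>
    have pt: "f y * (X y)\<^sup>2 \<le> 36 * T\<^sup>2 * f y + 18 * e * (f (?m y) * (X (?m y))\<^sup>2)" for y
    proof (cases "\<bar>X y\<bar> \<le> 6 * T")
      case True
      then have "(X y)\<^sup>2 \<le> (6 * T)\<^sup>2"
        by (metis abs_ge_zero power2_abs power_mono)
      then have "f y * (X y)\<^sup>2 \<le> f y * (6 * T)\<^sup>2"
        by (intro mult_left_mono nonneg)
      also have "\<dots> \<le> 36 * T\<^sup>2 * f y + 18 * e * (f (?m y) * (X (?m y))\<^sup>2)"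
        using nonneg e by (simp add: power2_eq_square)
      finally show ?thesis .
    next
      case False
      have w: "T \<le> \<bar>X (?m y)\<bar>" "\<bar>X y\<bar> \<le> 3 * \<bar>X (?m y)\<bar>"
      proof -
        have "2 * T \<le> \<bar>X z + X y\<bar>" "2 * \<bar>X y\<bar> \<le> 3 * \<bar>X z + X y\<bar>"
        proof -
          have "\<bar>X y\<bar> - \<bar>X z\<bar> \<le> \<bar>X z + X y\<bar>"
            by linarith
          then show "2 * T \<le> \<bar>X z + X y\<bar>" "2 * \<bar>X y\<bar> \<le> 3 * \<bar>X z + X y\<bar>"
            using False Xz T by simp_all
        qed
        then show "T \<le> \<bar>X (?m y)\<bar>" "\<bar>X y\<bar> \<le> 3 * \<bar>X (?m y)\<bar>"
          by (simp_all add: mid)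
      qed
      have "f z * f y \<le> (f (?m y))\<^sup>2"
        by (rule midpoint)
      also have "\<dots> \<le> (e * M) * f (?m y)"
        using small[OF w(1)] nonneg by (simp add: power2_eq_square mult_right_mono)
      also have "\<dots> \<le> (e * (2 * f z)) * f (?m y)"
        using z e nonneg by (intro mult_right_mono mult_left_mono) auto
      finally have "f z * f y \<le> f z * (2 * e * f (?m y))"
        by (simp add: algebra_simps)
      then have fy: "f y \<le> 2 * e * f (?m y)"
        using z M by (subst (asm) mult_le_cancel_left_pos) auto
      have "(X y)\<^sup>2 \<le> (3 * \<bar>X (?m y)\<bar>)\<^sup>2"
        using w(2) by (metis abs_ge_zero power2_abs power_mono)
      then have "f y * (X y)\<^sup>2 \<le> (2 * e * f (?m y)) * (3 * \<bar>X (?m y)\<bar>)\<^sup>2"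
        using e nonneg by (intro mult_mono fy) auto
      also have "\<dots> \<le> 36 * T\<^sup>2 * f y + 18 * e * (f (?m y) * (X (?m y))\<^sup>2)"
        using nonneg by (simp add: power_mult_distrib)
      finally show ?thesis .
    qed
    have "E2 \<le> integral\<^sup>L lebesgue (\<lambda>y. 36 * T\<^sup>2 * f y + 18 * e * (f (?m y) * (X (?m y))\<^sup>2))"
      unfolding E2_def
      by (intro integral_mono pt int_X) (use integ half(1)[OF int_X(2)] in auto)
    also have "\<dots> = 36 * T\<^sup>2 + 18 * e * integral\<^sup>L lebesgue (\<lambda>y. f (?m y) * (X (?m y))\<^sup>2)"
      using integ half(1)[OF int_X(2)] total by simp
    also have "integral\<^sup>L lebesgue (\<lambda>y. f (?m y) * (X (?m y))\<^sup>2) = D * E2"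
      unfolding E2_def by (rule half(2)[OF int_X(2)])
    \<comment> \<open>Absorbing \<open>E2 / 2\<close> leaves \<open>E2 \<le> 72 * T ^ 2\<close>,
      which contradicts \<open>big\<close>.\<close>
    finally have "E2 \<le> 36 * T\<^sup>2 + E2 / 2"
      using D by (simp add: e_def)
    then show ?thesis
      using big by (simp add: E2_def X_def)
  qed
  moreover have "e * T / (4 * D) = T / (144 * 4 ^ DIM('a))"
  proof -
    have "(4::real) ^ DIM('a) = D * D"
      by (simp add: D_def flip: power_mult_distrib)
    then show ?thesis by (simp add: e_def)
  qed
  ultimately show ?thesis
    by (simp add: E1_def X_def)
qed

text \<open>A centred \<open>X\<close> has the same integral of \<open>\<bar>X\<bar> + X\<close> as
  of \<open>\<bar>X\<bar>\<close>. This function is twice the positive part of \<open>X\<close>: at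
  most \<open>c / 2\<close> where \<open>X \<le> c / 4\<close>, and controlled elsewhere by the
  second moment and the mass of the half-space.\<close>

lemma halfspace_mass_lower_bound:
  assumes mean: "integral\<^sup>L lebesgue (\<lambda>x. f x * (\<theta> \<bullet> x - s)) = 0"
    and c: "0 < c" "c \<le> integral\<^sup>L lebesgue (\<lambda>x. f x * \<bar>\<theta> \<bullet> x - s\<bar>)"
    and C: "0 < C" "integral\<^sup>L lebesgue (\<lambda>x. f x * (\<theta> \<bullet> x - s)\<^sup>2) \<le> C"
  shows "c\<^sup>2 / (16 * C) \<le> integral\<^sup>L lebesgue (\<lambda>x. f x * indicator {x. \<theta> \<bullet> x - s > c / 4} x)"
proof -
  define X where "X = (\<lambda>x. \<theta> \<bullet> x - s)"
  \<comment> \<open>The weight in the inequality \<open>2 * u \<le> a * u ^ 2 + 1 / a\<close>. This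
    choice makes the second moment cost at most \<open>a * C = c / 4\<close>, so
    \<open>c / 4\<close> is left for the mass term.\<close>
  define a where "a = c / (4 * C)"
  define P where "P = integral\<^sup>L lebesgue (\<lambda>x. f x * indicator {x. X x > c / 4} x)"
  have a: "a > 0" using c C by (simp add: a_def)
  have X_meas[measurable]: "X \<in> borel_measurable borel"
    unfolding X_def by measurable
  have iP: "integrable lebesgue (\<lambda>x. f x * indicator {x. X x > c / 4} x)"
    by (rule integrable_quadratic[where A=1 and B=0]) (auto simp: indicator_def)
  have i: "integrable lebesgue (\<lambda>x. f x * \<bar>X x\<bar>)" "integrable lebesgue (\<lambda>x. f x * X x)"
     "integrable lebesgue (\<lambda>x. f x * (X x)\<^sup>2)"
    unfolding X_def by (rule integrable_affine_abs integrable_affine_lin integrable_affine_sq)+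
  have pt: "\<bar>u\<bar> + u \<le> c / 2 + a * u\<^sup>2 + (1 / a) * of_bool (u > c / 4)" for u :: real
  proof -
    have "2 * u \<le> a * u\<^sup>2 + 1 / a"
    proof -
      have "0 \<le> (a * u - 1)\<^sup>2 / a" using a by simp
      also have "\<dots> = a * u\<^sup>2 + 1 / a - 2 * u"
        using a by (simp add: power2_eq_square field_simps)
      finally show ?thesis by simp
    qed
    moreover have "0 \<le> a * u\<^sup>2" using a by simp
    ultimately show ?thesis
      using c by (cases "u > c / 4") (auto simp: abs_if)
  qed
  have "c \<le> integral\<^sup>L lebesgue (\<lambda>x. f x * \<bar>X x\<bar> + f x * X x)"
    using c mean i by (simp add: X_def)
  also have "\<dots> \<le> integral\<^sup>L lebesgue (\<lambda>x. (c / 2) * f x + a * (f x * (X x)\<^sup>2)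
      + (1 / a) * (f x * indicator {x. X x > c / 4} x))"
  proof (intro integral_mono)
    fix x
    show "f x * \<bar>X x\<bar> + f x * X x
      \<le> (c / 2) * f x + a * (f x * (X x)\<^sup>2) + (1 / a) * (f x * indicator {x. X x > c / 4} x)"
      using mult_left_mono[OF pt[of "X x"] nonneg[of x]]
      by (simp add: algebra_simps indicator_def)
  qed (use i iP integ in auto)
  also have "\<dots> = c / 2 + a * integral\<^sup>L lebesgue (\<lambda>x. f x * (X x)\<^sup>2) + (1 / a) * P"
    using i iP integ total by (simp add: P_def)
  also have "\<dots> \<le> c / 2 + a * C + (1 / a) * P"
    using C a by (simp add: X_def)
  also have "\<dots> = c / 2 + c / 4 + P * (4 * C / c)"
    using c C by (simp add: a_def)
  finally have "c / 4 \<le> P * (4 * C / c)"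
    by linarith
  then have "c / 4 * c \<le> P * (4 * C / c) * c"
    using c by (intro mult_right_mono) auto
  then have "c * c \<le> 16 * C * P"
    using c by (simp add: algebra_simps)
  then have "c\<^sup>2 / (16 * C) \<le> P"
    using C by (simp add: pos_divide_le_eq power2_eq_square algebra_simps)
  then show ?thesis
    by (simp add: P_def X_def)
qed

lemma integrable_norm_sq: "integrable lebesgue (\<lambda>x. f x * (norm (x - \<mu>))\<^sup>2)"
  and integral_norm_sq: "integral\<^sup>L lebesgue (\<lambda>x. f x * (norm (x - \<mu>))\<^sup>2) =
    (\<Sum>b\<in>Basis. integral\<^sup>L lebesgue (\<lambda>x. f x * (b \<bullet> x - b \<bullet> \<mu>)\<^sup>2))"
proof -
  have *: "(\<lambda>x. f x * (norm (x - \<mu>))\<^sup>2) = (\<lambda>x. \<Sum>b\<in>Basis. f x * (b \<bullet> x - b \<bullet> \<mu>)\<^sup>2)"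
  proof
    fix x
    have "(norm (x - \<mu>))\<^sup>2 = (\<Sum>b\<in>Basis. (b \<bullet> x - b \<bullet> \<mu>)\<^sup>2)"
      unfolding power2_norm_eq_inner
      by (subst euclidean_inner) (simp add: power2_eq_square inner_commute inner_diff_right)
    then show "f x * (norm (x - \<mu>))\<^sup>2 = (\<Sum>b\<in>Basis. f x * (b \<bullet> x - b \<bullet> \<mu>)\<^sup>2)"
      by (simp add: sum_distrib_left)
  qed
  show "integrable lebesgue (\<lambda>x. f x * (norm (x - \<mu>))\<^sup>2)"
    unfolding * by (intro Bochner_Integration.integrable_sum integrable_affine_sq)
  show "integral\<^sup>L lebesgue (\<lambda>x. f x * (norm (x - \<mu>))\<^sup>2) =
    (\<Sum>b\<in>Basis. integral\<^sup>L lebesgue (\<lambda>x. f x * (b \<bullet> x - b \<bullet> \<mu>)\<^sup>2))"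
    unfolding * by (intro Bochner_Integration.integral_sum integrable_affine_sq)
qed

text \<open>The radius \<open>c / 4\<close> is the threshold of
  \<open>halfspace_mass_lower_bound\<close>, so for every direction the half-space beyond that
  threshold lies beyond the hyperplane through \<open>q\<close>. The assumptions \<open>R\<close>
  and \<open>m\<close> give each half of \<open>c ^ 2 / (16 * C)\<close> to one part of its mass:
  Chebyshev outside \<open>cball \<mu> R\<close>, and \<open>f < m\<close> inside.\<close>

lemma superlevel_ball:
  assumes mean: "\<And>\<theta>. integral\<^sup>L lebesgue (\<lambda>x. f x * (\<theta> \<bullet> x - \<theta> \<bullet> \<mu>)) = 0"
    and low: "\<And>\<theta>. norm \<theta> = 1 \<Longrightarrow> c \<le> integral\<^sup>L lebesgue (\<lambda>x. f x * \<bar>\<theta> \<bullet> x - \<theta> \<bullet> \<mu>\<bar>)"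
    and up: "\<And>\<theta>. norm \<theta> = 1 \<Longrightarrow> integral\<^sup>L lebesgue (\<lambda>x. f x * (\<theta> \<bullet> x - \<theta> \<bullet> \<mu>)\<^sup>2) \<le> C"
    and pos: "0 < c" "0 < C" "0 < R" "0 < m"
    and R: "C * DIM('a) / R\<^sup>2 < c\<^sup>2 / (32 * C)"
    and m: "m * measure lborel (cball (0::'a) R) \<le> c\<^sup>2 / (32 * C)"
    and q: "q \<in> cball \<mu> (c / 4)"
  shows "m \<le> f q"
proof (rule ccontr)
  assume fq: "\<not> m \<le> f q"
  let ?S = "(\<lambda>x. x - q) ` {x. m \<le> f x}"
  have "convex ?S"
    using convex_translation[OF convex_superlevel, of "- q"] by simp
  moreover have "0 \<notin> ?S"
    using fq by auto
  ultimately obtain a where a: "a \<noteq> 0" "\<forall>x\<in>?S. 0 \<le> a \<bullet> x"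
    using separating_hyperplane_set_0 by blast
  \<comment> \<open>The sign makes \<open>\<theta>\<close> point away from the superlevel
    set.\<close>
  define \<theta> where "\<theta> = - (a /\<^sub>R norm a)"
  have \<theta>: "norm \<theta> = 1"
    using a by (simp add: \<theta>_def)
  have out: "f x < m" if x: "\<theta> \<bullet> x - \<theta> \<bullet> \<mu> > c / 4" for x
  proof (rule ccontr)
    assume "\<not> f x < m"
    then have "0 \<le> a \<bullet> (x - q)"
      using a by auto
    then have "\<theta> \<bullet> (x - q) \<le> 0"
      by (simp add: \<theta>_def)
    moreover have "\<theta> \<bullet> (q - \<mu>) \<le> c / 4"
      using Cauchy_Schwarz_ineq2[of \<theta> "q - \<mu>"] \<theta> q by (simp add: dist_norm norm_minus_commute)
    ultimately show False
      using x by (simp add: inner_diff_right)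
  qed
  let ?H = "{x. \<theta> \<bullet> x - \<theta> \<bullet> \<mu> > c / 4}"
  have iH: "integrable lebesgue (\<lambda>x. f x * indicator ?H x)"
    by (rule integrable_quadratic[where A=1 and B=0]) (auto simp: indicator_def)
  have iB: "integrable lebesgue (indicator (cball \<mu> R) :: 'a \<Rightarrow> real)"
    using emeasure_lborel_cball_finite[of \<mu> R] by (intro integrable_real_indicator) auto
  have "c\<^sup>2 / (16 * C) \<le> integral\<^sup>L lebesgue (\<lambda>x. f x * indicator ?H x)"
    by (rule halfspace_mass_lower_bound[OF mean pos(1) low[OF \<theta>] pos(2) up[OF \<theta>]])
  also have "\<dots> \<le> integral\<^sup>L lebesgue (\<lambda>x. m * indicator (cball \<mu> R) x + (1 / R\<^sup>2) * (f x * (norm (x - \<mu>))\<^sup>2))"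
  proof (intro integral_mono iH)
    show "integrable lebesgue (\<lambda>x. m * indicator (cball \<mu> R) x + (1 / R\<^sup>2) * (f x * (norm (x - \<mu>))\<^sup>2))"
      using iB integrable_norm_sq by (intro Bochner_Integration.integrable_add integrable_mult_right) auto
    fix x
    have nn: "0 \<le> (1 / R\<^sup>2) * (f x * (norm (x - \<mu>))\<^sup>2)" "0 \<le> m * indicator (cball \<mu> R) x"
      using nonneg pos by auto
    show "f x * indicator ?H x \<le> m * indicator (cball \<mu> R) x + (1 / R\<^sup>2) * (f x * (norm (x - \<mu>))\<^sup>2)"
    proof (cases "x \<in> ?H")
      case False
      then show ?thesis using nn by simp
    next
      case H: True
      show ?thesis
      proof (cases "x \<in> cball \<mu> R")
        case True
        then show ?thesis using nn H out[of x] by simp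
      next
        case False
        then have "R\<^sup>2 \<le> (norm (x - \<mu>))\<^sup>2"
          using pos by (intro power_mono) (auto simp: dist_norm norm_minus_commute)
        then have "f x * R\<^sup>2 \<le> f x * (norm (x - \<mu>))\<^sup>2"
          by (intro mult_left_mono nonneg)
        then show ?thesis
          using H False pos by (simp add: field_simps)
      qed
    qed
  qed
  also have "\<dots> = m * measure lborel (cball \<mu> R) + (1 / R\<^sup>2) * integral\<^sup>L lebesgue (\<lambda>x. f x * (norm (x - \<mu>))\<^sup>2)"
    using iB integrable_norm_sq[of \<mu>] by simp
  also have "integral\<^sup>L lebesgue (\<lambda>x. f x * (norm (x - \<mu>))\<^sup>2) \<le> DIM('a) * C"
    unfolding integral_norm_sq by (rule sum_bounded_above) (auto intro: up)
  also have "measure lborel (cball \<mu> R) = measure lborel (cball (0::'a) R)"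
    using pos by (simp add: content_cball)
  finally have "c\<^sup>2 / (16 * C) \<le> m * measure lborel (cball (0::'a) R) + C * DIM('a) / R\<^sup>2"
    using pos by (simp add: mult.commute divide_right_mono)
  moreover have "c\<^sup>2 / (16 * C) = c\<^sup>2 / (32 * C) + c\<^sup>2 / (32 * C)"
    by simp
  ultimately show False
    using R m by linarith
qed

end

section \<open>The L1 distance between a density and its translates\<close>

context log_concave_density
begin

lemma translation_difference_bound:
  assumes m: "m > 0" and r: "r > 0" and ge: "\<And>x. x \<in> cball p r \<Longrightarrow> m \<le> f x"
    and M: "\<And>x. f x \<le> M" and v: "norm v = 1" and k: "0 \<le> k"
  shows "integral\<^sup>L lebesgue (\<lambda>x. \<bar>f (x + k *\<^sub>R v) - f x\<bar>) \<le> 2 / r * (DIM('a) + ln (M / m)) * k"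
proof -
  have i: "integrable lebesgue (\<lambda>x. f (x + k *\<^sub>R v))"
    using integrable_affine[OF integ, of 1 "k *\<^sub>R v"] by (simp add: add.commute)
  have total': "integral\<^sup>L lebesgue (\<lambda>x. f (x + k *\<^sub>R v)) = 1"
    using integral_affine[OF integ, of 1 "k *\<^sub>R v"] total by (simp add: add.commute)
  have mM: "m \<le> M"
    using ge[of p] M[of p] r by auto
  then have ln: "ln (M / m) \<ge> 0"
    using m by simp
  show ?thesis
  proof (cases "k < r")
    \<comment> \<open>For \<open>k \<ge> r\<close> the trivial bound 2 is enough, because
      \<open>DIM('a) \<ge> 1\<close> and the logarithm is nonnegative.\<close>
    case False
    have "integral\<^sup>L lebesgue (\<lambda>x. \<bar>f (x + k *\<^sub>R v) - f x\<bar>)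
        \<le> integral\<^sup>L lebesgue (\<lambda>x. f (x + k *\<^sub>R v) + f x)"
    proof (intro integral_mono)
      fix x show "\<bar>f (x + k *\<^sub>R v) - f x\<bar> \<le> f (x + k *\<^sub>R v) + f x"
        using nonneg[of x] nonneg[of "x + k *\<^sub>R v"] by linarith
    qed (use i integ in auto)
    also have "\<dots> = 2"
      using i integ total total' by simp
    also have "\<dots> \<le> 2 * (DIM('a) + ln (M / m)) * (k / r)"
    proof -
      have "(1::real) * 1 \<le> (DIM('a) + ln (M / m)) * (k / r)"
        using False r ln by (intro mult_mono) (auto simp: field_simps Suc_le_eq intro: add_increasing2)
      then show ?thesis by (simp only: mult.assoc)
    qed
    finally show ?thesis by (simp add: field_simps)
  next
    case True
    define l where "l = k / r"
    have l: "0 \<le> l" "l < 1" "l * r = k"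
      using True k r by (auto simp: l_def)
    define A where "A = (m / M) powr l"
    have A1: "A \<le> 1"
      unfolding A_def using l m mM by (intro powr_le1) auto
    \<comment> \<open>The tangent of the exponential here, and Bernoulli's inequality for
      \<open>D\<close> below, make both losses linear in \<open>l\<close> and thus in
      \<open>k\<close>.\<close>
    have "1 + l * ln (m / M) \<le> A"
      using exp_ge_add_one_self[of "l * ln (m / M)"] m mM by (simp add: A_def powr_def)
    then have A2: "1 - A \<le> l * ln (M / m)"
      using m mM by (simp add: ln_div algebra_simps)
    define D where "D = (1 - l) ^ DIM('a)"
    have D: "0 < D" "1 - l * DIM('a) \<le> D"
      using Bernoulli_inequality[of "- l" "DIM('a)"] l by (auto simp: D_def mult.commute)
    \<comment> \<open>The contraction towards \<open>p\<close> by the factor \<open>1 - l\<close>.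
      The identity \<open>l * r = k\<close> is what lets the choice of a point in
      \<open>cball p r\<close> move the image of \<open>x\<close> by any vector of length at most
      \<open>k\<close>.\<close>
    define w where "w = (\<lambda>x. l *\<^sub>R p + (1 - l) *\<^sub>R x)"
    have key: "A * f x \<le> f (w x + k *\<^sub>R u)" if u: "norm u \<le> 1" for x u
    proof (cases "f x = 0")
      case True
      then show ?thesis using nonneg by simp
    next
      case False
      then have fx: "f x > 0" using nonneg[of x] by simp
      have "p + r *\<^sub>R u \<in> cball p r"
        using u r by (simp add: dist_norm)
      then have z: "m \<le> f (p + r *\<^sub>R u)"
        by (rule ge)
      \<comment> \<open>Replacing \<open>M\<close> by the smaller \<open>f x\<close> turns
        \<open>A * f x\<close> into a weighted geometric mean of \<open>f x\<close> and
        \<open>m\<close>, to which log-concavity applies.\<close>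
      have "A \<le> (m / f x) powr l"
        unfolding A_def using l m mM fx M by (intro powr_mono2 frac_le) auto
      then have "A * f x \<le> (m / f x) powr l * f x"
        using fx by simp
      also have "\<dots> = f x powr (1 - l) * m powr l"
        using m fx by (simp add: powr_divide powr_diff)
      also have "\<dots> \<le> f x powr (1 - l) * f (p + r *\<^sub>R u) powr l"
        using z m l by (intro mult_left_mono powr_mono2) auto
      also have "\<dots> \<le> f ((1 - l) *\<^sub>R x + l *\<^sub>R (p + r *\<^sub>R u))"
        using l by (intro lc) auto
      also have "(1 - l) *\<^sub>R x + l *\<^sub>R (p + r *\<^sub>R u) = w x + k *\<^sub>R u"
        using l(3) by (simp add: w_def algebra_simps)
      finally show ?thesis .
    qed
    have sub: "integrable lebesgue (\<lambda>x. g (w x))"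
       "integral\<^sup>L lebesgue g = D * integral\<^sup>L lebesgue (\<lambda>x. g (w x))"
      if "integrable lebesgue g" for g :: "'a \<Rightarrow> real"
      using integrable_affine[OF that, of "1 - l" "l *\<^sub>R p"] integral_affine[OF that, of "1 - l" "l *\<^sub>R p"] l
      by (auto simp: D_def w_def)
    let ?d = "\<lambda>x. \<bar>f (x + k *\<^sub>R v) - f x\<bar>"
    have id: "integrable lebesgue ?d"
      using i integ by auto
    have "integral\<^sup>L lebesgue ?d = D * integral\<^sup>L lebesgue (\<lambda>x. ?d (w x))"
      by (rule sub(2)[OF id])
    also have "\<dots> \<le> D * integral\<^sup>L lebesgue (\<lambda>x. f (w x + k *\<^sub>R v) + f (w x) - 2 * A * f x)"
    proof (intro mult_left_mono integral_mono)
      fix x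
      \<comment> \<open>\<open>key\<close> with \<open>u = v\<close> and with \<open>u = 0\<close>
        puts both values above \<open>A * f x\<close>, and the difference of two numbers is at most
        their sum minus twice a common lower bound.\<close>
      show "?d (w x) \<le> f (w x + k *\<^sub>R v) + f (w x) - 2 * A * f x"
        using key[of v x] key[of 0 x] v by (simp add: abs_if)
    qed (use sub(1)[OF i] sub(1)[OF integ] sub(1)[OF id] integ D in auto)
    also have "\<dots> = D * integral\<^sup>L lebesgue (\<lambda>x. f (w x + k *\<^sub>R v)) + D * integral\<^sup>L lebesgue (\<lambda>x. f (w x)) - 2 * A * D"
      using sub(1)[OF i] sub(1)[OF integ] integ total by (simp add: algebra_simps)
    also have "\<dots> = 2 - 2 * A * D"
      using sub(2)[OF i] sub(2)[OF integ] total total' by simp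
    also have "\<dots> = 2 * ((1 - A) + A * (1 - D))"
      by (simp add: algebra_simps)
    also have "A * (1 - D) \<le> 1 * (l * DIM('a))"
      using A1 D(2) l by (intro mult_mono') (auto simp: A_def D_def power_le_one)
    also note A2
    finally have "integral\<^sup>L lebesgue ?d \<le> 2 * (l * ln (M / m) + 1 * (l * DIM('a)))"
      by simp
    also have "\<dots> = 2 / r * (DIM('a) + ln (M / m)) * k"
      by (simp add: l_def algebra_simps add_divide_distrib)
    finally show ?thesis .
  qed
qed

end

section \<open>Decay away from the mean and the exponential tail\<close>

context log_concave_density2
begin

text \<open>If \<open>f x \<ge> m / exp 1\<close>, contracting \<open>cball \<mu> r\<close> by 1/2
  towards \<open>x\<close> yields a ball of radius \<open>r/2\<close> with
  \<open>f \<ge> m / exp 1\<close>, all of it at distance at least \<open>(R - r) / 2\<close> from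
  \<open>\<mu>\<close>. It would contribute more than \<open>S\<close> to the second moment.\<close>

lemma decay_radius:
  assumes m: "m > 0" and r: "r > 0" and ge: "\<And>x. x \<in> cball \<mu> r \<Longrightarrow> m \<le> f x"
    and S: "integral\<^sup>L lebesgue (\<lambda>x. f x * (norm (x - \<mu>))\<^sup>2) \<le> S"
    and R: "r < R" "4 * S * exp 1 < (R - r)\<^sup>2 * m * measure lborel (cball (0::'a) (r/2))"
    and x: "R \<le> norm (x - \<mu>)"
  shows "f x < m / exp 1"
proof (rule ccontr)
  assume "\<not> f x < m / exp 1"
  then have fx: "m / exp 1 \<le> f x" by simp
  let ?q = "(1/2) *\<^sub>R x + (1/2) *\<^sub>R \<mu>"
  have "(m / exp 1) * ((R - r) / 2)\<^sup>2 \<le> f y * (norm (y - \<mu>))\<^sup>2" if y: "y \<in> cball ?q (r/2)" for y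
  proof -
    let ?z = "2 *\<^sub>R y - x"
    have eq: "?z - \<mu> = 2 *\<^sub>R (y - ?q)"
      by (simp add: algebra_simps)
    have yq: "norm (y - ?q) \<le> r / 2"
      using y by (simp add: dist_norm norm_minus_commute)
    then have "norm (?z - \<mu>) \<le> r"
      unfolding eq by simp
    then have z: "m \<le> f ?z"
      by (intro ge) (simp add: dist_norm norm_minus_commute)
    have "(m / exp 1)\<^sup>2 \<le> (m / exp 1) * m"
      using m by (simp add: power2_eq_square field_simps)
    also have "\<dots> \<le> f x * f ?z"
      using fx z m nonneg by (intro mult_mono) auto
    also have "\<dots> \<le> (f y)\<^sup>2"
      using midpoint[of x ?z] by (simp add: algebra_simps)
    finally have fy: "m / exp 1 \<le> f y"
      using nonneg by (rule power2_le_imp_le)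
    have "?q - \<mu> = (1/2) *\<^sub>R (x - \<mu>)"
      by (simp add: algebra_simps) (metis scaleR_add_right scaleR_half_double)
    then have "R / 2 \<le> norm (?q - \<mu>)"
      using x by simp
    also have "norm (?q - \<mu>) \<le> norm (y - \<mu>) + norm (y - ?q)"
    proof -
      have "?q - \<mu> = (y - \<mu>) - (y - ?q)" by simp
      then show ?thesis
        by (metis norm_triangle_ineq4)
    qed
    finally have "(R - r) / 2 \<le> norm (y - \<mu>)"
      using yq unfolding diff_divide_distrib by argo
    then show ?thesis
      using fy m R nonneg by (intro mult_mono power_mono) auto
  qed
  then have "(m / exp 1) * ((R - r) / 2)\<^sup>2 * measure lborel (cball ?q (r/2))
      \<le> integral\<^sup>L lebesgue (\<lambda>x. f x * (norm (x - \<mu>))\<^sup>2)"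
    using nonneg by (intro ball_mass_le_integral integrable_norm_sq) auto
  also note S
  also have "measure lborel (cball ?q (r/2)) = measure lborel (cball (0::'a) (r/2))"
    using r by (simp add: content_cball)
  finally have "(m / exp 1) * ((R - r) / 2)\<^sup>2 * measure lborel (cball (0::'a) (r/2)) * (4 * exp 1) \<le> S * (4 * exp 1)"
    by (intro mult_right_mono) auto
  then show False
    using R by (simp add: power_divide mult_ac)
qed

end

context log_concave_density
begin

lemma integrable_outside_ball:
  "integrable lebesgue (\<lambda>x. f x * indicator {x. norm (x - \<mu>) > t} x)"
proof (rule integrable_real_mult_indicator[OF _ integ])
  have "{x. norm (x - \<mu>) > t} \<in> sets lborel"
    by simp
  then show "{x. norm (x - \<mu>) > t} \<in> sets lebesgue"
    by (rule sets_completionI_sets)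
qed

text \<open>If \<open>y\<close> is at distance more than \<open>s * R\<close> from
  \<open>\<mu>\<close>, the point \<open>x\<close> at the fraction \<open>1 / s\<close> of the way
  from \<open>\<mu>\<close> to \<open>y\<close> satisfies \<open>f x < m / exp 1\<close>.
  Log-concavity on this segment gives \<open>f y \<le> f x * (f x / m) powr (s - 1)\<close>, at most
  \<open>exp (1 - s) * f x\<close>; the substitution contributes the Jacobian
  \<open>s ^ DIM('a)\<close>.\<close>

lemma tail_dilation:
  assumes m: "m > 0" and mu: "m \<le> f \<mu>" and decay: "\<And>x. R \<le> norm (x - \<mu>) \<Longrightarrow> f x < m / exp 1"
    and s: "1 \<le> s"
  shows "integral\<^sup>L lebesgue (\<lambda>x. f x * indicator {x. norm (x - \<mu>) > s * R} x) \<le> s ^ DIM('a) * exp (1 - s)"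
proof -
  have s0: "s > 0" using s by simp
  define h where "h = (\<lambda>x. f x * indicator {x. norm (x - \<mu>) > s * R} x)"
  define w where "w = (\<lambda>x. (1 - s) *\<^sub>R \<mu> + s *\<^sub>R x)"
  have ih: "integrable lebesgue h"
    unfolding h_def by (rule integrable_outside_ball)
  have pt: "h (w x) \<le> exp (1 - s) * f x" for x
  proof (cases "norm (w x - \<mu>) > s * R \<and> f (w x) \<noteq> 0")
    case False
    then show ?thesis using nonneg by (auto simp: h_def)
  next
    case True
    define y where "y = w x"
    have fy: "f y > 0"
      using True nonneg[of y] by (simp add: y_def)
    have "w x - \<mu> = s *\<^sub>R (x - \<mu>)"
      by (simp add: w_def algebra_simps)
    then have "R < norm (x - \<mu>)"
      using True s0 by simp
    then have fx: "f x \<le> m / exp 1"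
      using decay[of x] by simp
    have "m powr (1 - 1 / s) * f y powr (1 / s) \<le> f \<mu> powr (1 - 1 / s) * f y powr (1 / s)"
      using s m mu by (intro mult_right_mono powr_mono2) auto
    also have "\<dots> \<le> f ((1 - 1 / s) *\<^sub>R \<mu> + (1 / s) *\<^sub>R y)"
      using s by (intro lc) auto
    also have "(1 - 1 / s) *\<^sub>R \<mu> + (1 / s) *\<^sub>R y = x"
      using s0 by (simp add: y_def w_def algebra_simps)
    finally have "m powr (1 - 1 / s) * f y powr (1 / s) \<le> f x" .
    then have "(m powr (1 - 1 / s) * f y powr (1 / s)) powr s \<le> f x powr s"
      using s0 by (intro powr_mono2) auto
    then have *: "m powr (s - 1) * f y \<le> f x powr s"
      using s0 fy by (simp add: powr_mult powr_powr algebra_simps)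
    have "0 < m powr (1 - 1 / s) * f y powr (1 / s)"
      using m fy by simp
    then have fx0: "f x > 0"
      using \<open>m powr (1 - 1 / s) * f y powr (1 / s) \<le> f x\<close> by linarith
    have "f x powr s = f x * f x powr (s - 1)"
      using fx0 by (simp add: powr_diff)
    also have "\<dots> \<le> f x * (m / exp 1) powr (s - 1)"
      using fx0 fx s by (intro mult_left_mono powr_mono2) auto
    also have "(m / exp 1) powr (s - 1) = m powr (s - 1) * exp (1 - s)"
      using m by (simp add: powr_divide powr_def[of "exp 1"] exp_diff)
    finally have "m powr (s - 1) * f y \<le> m powr (s - 1) * (exp (1 - s) * f x)"
      using * by (simp add: algebra_simps)
    then have "f y \<le> exp (1 - s) * f x"
      using m by simp
    then show ?thesis
      using True by (simp add: h_def y_def)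
  qed
  have "integral\<^sup>L lebesgue h = s ^ DIM('a) * integral\<^sup>L lebesgue (\<lambda>x. h (w x))"
    using integral_affine[OF ih, of s "(1 - s) *\<^sub>R \<mu>"] s0 by (simp add: w_def)
  also have "\<dots> \<le> s ^ DIM('a) * integral\<^sup>L lebesgue (\<lambda>x. exp (1 - s) * f x)"
    using integrable_affine[OF ih, of s "(1 - s) *\<^sub>R \<mu>"] s0 integ
    by (intro mult_left_mono integral_mono pt) (auto simp: w_def)
  finally show ?thesis
    using total by (simp add: h_def)
qed

lemma tail_mass_le_one:
  "integral\<^sup>L lebesgue (\<lambda>x. f x * indicator {x. norm (x - \<mu>) > t} x) \<le> 1"
proof -
  have "integral\<^sup>L lebesgue (\<lambda>x. f x * indicator {x. norm (x - \<mu>) > t} x) \<le> integral\<^sup>L lebesgue f"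
    by (intro integral_mono integ integrable_outside_ball) (auto simp: indicator_def nonneg)
  then show ?thesis by (simp add: total)
qed

text \<open>Half of the exponent in \<open>tail_dilation\<close> pays for the polynomial factor, via
  \<open>(1 + x / n) ^ n \<le> exp x\<close> at \<open>x = s / 2\<close>. The factor
  \<open>exp 1\<close> also covers \<open>t < R\<close>, where only the total mass is used.\<close>

lemma exponential_tail:
  assumes m: "m > 0" and mu: "m \<le> f \<mu>" and decay: "\<And>x. R \<le> norm (x - \<mu>) \<Longrightarrow> f x < m / exp 1"
    and R: "R > 0" and t: "t > 0"
  shows "integral\<^sup>L lebesgue (\<lambda>x. f x * indicator {x. norm (x - \<mu>) > t} x)
    \<le> exp 1 * (2 * DIM('a)) ^ DIM('a) * exp (- (1 / (2 * R)) * t)"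
proof -
  define s where "s = t / R"
  define n where "n = DIM('a)"
  have n: "n > 0" by (simp add: n_def)
  have s: "s > 0" "t = s * R" using t R by (auto simp: s_def)
  have "(1::real) \<le> (2 * n) ^ n"
    using n one_le_power[of "2 * n" n] by (simp only: real_of_nat_ge_one_iff)
  have "integral\<^sup>L lebesgue (\<lambda>x. f x * indicator {x. norm (x - \<mu>) > t} x) \<le> exp 1 * (2 * n) ^ n * exp (- s / 2)"
  proof (cases "s \<ge> 1")
    case True
    have "(s / (2 * n)) ^ n \<le> (1 + (s / 2) / n) ^ n"
      using s by (intro power_mono) (auto simp: field_simps)
    also have "\<dots> \<le> exp (s / 2)"
      using s n by (intro exp_ge_one_plus_x_over_n_power_n) auto
    finally have sn: "s ^ n \<le> (2 * n) ^ n * exp (s / 2)"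
      using n by (simp add: power_divide pos_divide_le_eq mult.commute)
    have "integral\<^sup>L lebesgue (\<lambda>x. f x * indicator {x. norm (x - \<mu>) > t} x) \<le> s ^ n * exp (1 - s)"
      unfolding n_def s(2) by (rule tail_dilation[OF m mu decay True])
    also have "\<dots> \<le> ((2 * n) ^ n * exp (s / 2)) * exp (1 - s)"
      by (intro mult_right_mono sn) auto
    also have "exp (1 - s) = exp 1 * exp (- s)"
      by (simp flip: exp_add)
    also have "(2 * n) ^ n * exp (s / 2) * (exp 1 * exp (- s)) = exp 1 * (2 * n) ^ n * (exp (s / 2) * exp (- s))"
      by (simp only: mult_ac)
    also have "exp (s / 2) * exp (- s) = exp (- s / 2)"
      by (simp flip: exp_add)
    finally show ?thesis .
  next
    case False
    have "integral\<^sup>L lebesgue (\<lambda>x. f x * indicator {x. norm (x - \<mu>) > t} x) \<le> 1"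
      by (rule tail_mass_le_one)
    also have "1 \<le> exp (1 + - s / 2)"
      using False by simp
    also have "\<dots> = exp 1 * 1 * exp (- s / 2)"
      by (simp only: exp_add mult_1_right)
    also have "\<dots> \<le> exp 1 * (2 * n) ^ n * exp (- s / 2)"
      using \<open>(1::real) \<le> (2 * n) ^ n\<close> by (intro mult_right_mono mult_left_mono) auto
    finally show ?thesis .
  qed
  then show ?thesis
    by (simp add: n_def s_def mult.commute)
qed

end

section \<open>Variances, and the passage from the definitions to the locales\<close>

lemma (in log_concave_density2) second_moment_pos:
  assumes \<theta>: "\<theta> \<noteq> 0"
  shows "0 < integral\<^sup>L lebesgue (\<lambda>x. f x * (\<theta> \<bullet> x - s)\<^sup>2)"
proof (rule ccontr)
  assume "\<not> ?thesis"
  moreover have "0 \<le> integral\<^sup>L lebesgue (\<lambda>x. f x * (\<theta> \<bullet> x - s)\<^sup>2)"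
    by (intro integral_nonneg_AE) (auto simp: nonneg)
  ultimately have "integral\<^sup>L lebesgue (\<lambda>x. f x * (\<theta> \<bullet> x - s)\<^sup>2) = 0"
    by simp
  then have "AE x in lebesgue. f x * (\<theta> \<bullet> x - s)\<^sup>2 = 0"
    by (subst (asm) integral_nonneg_eq_0_iff_AE[OF integrable_affine_sq]) (auto simp: nonneg)
  moreover have "negligible {x. \<theta> \<bullet> x = s}"
    using \<theta> by (intro negligible_hyperplane) simp
  then have "AE x in lebesgue. \<theta> \<bullet> x \<noteq> s"
    by (intro AE_I'[where N="{x. \<theta> \<bullet> x = s}"]) (auto simp: negligible_iff_null_sets)
  ultimately have "AE x in lebesgue. f x = 0"
    by eventually_elim auto
  then have "integral\<^sup>L lebesgue f = 0"
    by (rule integral_eq_zero_AE)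
  then show False using total by simp
qed

lemma log_concave_powr:
  assumes f: "log_concave f" and t: "0 \<le> t" "t \<le> 1"
  shows "f x powr (1 - t) * f y powr t \<le> f ((1 - t) *\<^sub>R x + t *\<^sub>R y)"
proof -
  let ?z = "(1 - t) *\<^sub>R x + t *\<^sub>R y"
  obtain \<phi> where \<phi>: "\<And>x. \<phi> x < \<infinity>" "ereal_concave \<phi>"
    and feq: "\<And>x. f x = (if \<phi> x = -\<infinity> then 0 else exp (real_of_ereal (\<phi> x)))"
    using f unfolding log_concave_def by blast
  show ?thesis
  proof (cases "\<phi> x = -\<infinity> \<or> \<phi> y = -\<infinity>")
    \<comment> \<open>Where \<open>\<phi>\<close> is infinite, \<open>f\<close> vanishes. As
      \<open>0 powr 0 = 0\<close>, the product is zero even for \<open>t = 0\<close> and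
      \<open>t = 1\<close>.\<close>
    case True
    then have "f x powr (1 - t) * f y powr t = 0"
      by (auto simp: feq)
    also have "0 \<le> f ?z" by (simp add: feq)
    finally show ?thesis .
  next
    case False
    then obtain a b where ab: "\<phi> x = ereal a" "\<phi> y = ereal b"
      using \<phi>(1)[of x] \<phi>(1)[of y] by (cases "\<phi> x"; cases "\<phi> y") auto
    have "ereal (1 - t) * \<phi> x + ereal t * \<phi> y \<le> \<phi> ?z"
      using \<phi>(2) t unfolding ereal_concave_def by blast
    then have le: "ereal ((1 - t) * a + t * b) \<le> \<phi> ?z"
      by (simp add: ab)
    then obtain d where d: "\<phi> ?z = ereal d"
      using \<phi>(1)[of ?z] by (cases "\<phi> ?z") auto
    have "f x powr (1 - t) * f y powr t = exp ((1 - t) * a + t * b)"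
      by (simp add: feq ab powr_def exp_add)
    also have "\<dots> \<le> exp d"
      using le d by simp
    also have "\<dots> = f ?z"
      by (simp add: feq d)
    finally show ?thesis .
  qed
qed

lemma isotropic_log_concave_density2:
  fixes f :: "real^'n \<Rightarrow> real"
  assumes "is_density f" "log_concave f" "nearly_isotropic C f"
  shows "log_concave_density2 f"
proof
  have "(\<lambda>x. f x * (norm x)\<^sup>2) = (\<lambda>x. \<Sum>i\<in>UNIV. f x * (x $ i)\<^sup>2)"
    unfolding power2_norm_eq_inner by (simp add: inner_vec_def power2_eq_square sum_distrib_left)
  then show "integrable lebesgue (\<lambda>x. f x * (norm x)\<^sup>2)"
    using assms by (simp add: nearly_isotropic_def)
qed (use assms in \<open>auto simp: is_density_def intro: log_concave_powr\<close>)

lemma density_mean_centered: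
  fixes f :: "real^'n \<Rightarrow> real"
  assumes "log_concave_density2 f"
  shows "integral\<^sup>L lebesgue (\<lambda>x. f x * (\<theta> \<bullet> x - \<theta> \<bullet> density_mean f)) = 0"
proof -
  interpret log_concave_density2 f by fact
  have i: "integrable lebesgue (\<lambda>x. f x * x $ i)" for i
    using integrable_affine_lin[of "axis i 1" 0] by (simp add: inner_axis')
  have eq: "(\<lambda>x. f x * (\<theta> \<bullet> x - \<theta> \<bullet> density_mean f)) =
      (\<lambda>x. (\<Sum>i\<in>UNIV. \<theta> $ i * (f x * x $ i)) - (\<theta> \<bullet> density_mean f) * f x)"
    by (simp add: fun_eq_iff inner_vec_def sum_distrib_left algebra_simps)
  have "integral\<^sup>L lebesgue (\<lambda>x. f x * (\<theta> \<bullet> x - \<theta> \<bullet> density_mean f)) =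
      (\<Sum>i\<in>UNIV. \<theta> $ i * integral\<^sup>L lebesgue (\<lambda>x. f x * x $ i)) - \<theta> \<bullet> density_mean f"
    unfolding eq using i integ total by simp
  also have "\<dots> = 0"
    by (simp add: inner_vec_def density_mean_def)
  finally show ?thesis .
qed

lemma covariance_quadratic_form:
  fixes f :: "real^'n \<Rightarrow> real"
  assumes "log_concave_density2 f"
  shows "\<theta> \<bullet> (covariance_matrix f *v \<theta>) =
    integral\<^sup>L lebesgue (\<lambda>x. f x * (\<theta> \<bullet> x - \<theta> \<bullet> density_mean f)\<^sup>2)"
proof -
  interpret log_concave_density2 f by fact
  let ?\<mu> = "density_mean f"
  have i: "integrable lebesgue (\<lambda>x. f x * ((x $ i - ?\<mu> $ i) * (x $ j - ?\<mu> $ j)))" for i j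
  proof (rule integrable_quadratic[where A="2 * (norm ?\<mu>)\<^sup>2" and B=2])
    fix x
    have "\<bar>(x $ i - ?\<mu> $ i) * (x $ j - ?\<mu> $ j)\<bar> \<le> norm (x - ?\<mu>) * norm (x - ?\<mu>)"
      unfolding abs_mult
      using component_le_norm_cart[of "x - ?\<mu>" i] component_le_norm_cart[of "x - ?\<mu>" j]
      by (intro mult_mono) auto
    also have "\<dots> \<le> (norm x + norm ?\<mu>) * (norm x + norm ?\<mu>)"
      by (intro mult_mono norm_triangle_ineq4) auto
    also have "\<dots> \<le> 2 * (norm ?\<mu>)\<^sup>2 + 2 * (norm x)\<^sup>2"
      using zero_le_power2[of "norm x - norm ?\<mu>"] by (simp add: power2_eq_square algebra_simps)
    finally show "\<bar>(x $ i - ?\<mu> $ i) * (x $ j - ?\<mu> $ j)\<bar> \<le> 2 * (norm ?\<mu>)\<^sup>2 + 2 * (norm x)\<^sup>2" .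
  qed measurable
  have eq: "(\<lambda>x. f x * (\<theta> \<bullet> x - \<theta> \<bullet> ?\<mu>)\<^sup>2) =
      (\<lambda>x. \<Sum>i\<in>UNIV. \<Sum>j\<in>UNIV. (\<theta> $ i * \<theta> $ j) * (f x * ((x $ i - ?\<mu> $ i) * (x $ j - ?\<mu> $ j))))"
  proof
    fix x
    have "(\<theta> \<bullet> x - \<theta> \<bullet> ?\<mu>)\<^sup>2 = (\<Sum>i\<in>UNIV. \<theta> $ i * (x $ i - ?\<mu> $ i)) * (\<Sum>j\<in>UNIV. \<theta> $ j * (x $ j - ?\<mu> $ j))"
      by (simp add: inner_vec_def power2_eq_square right_diff_distrib sum_subtractf)
    then show "f x * (\<theta> \<bullet> x - \<theta> \<bullet> ?\<mu>)\<^sup>2 =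
      (\<Sum>i\<in>UNIV. \<Sum>j\<in>UNIV. (\<theta> $ i * \<theta> $ j) * (f x * ((x $ i - ?\<mu> $ i) * (x $ j - ?\<mu> $ j))))"
      by (simp only: sum_product) (simp add: sum_distrib_left mult_ac)
  qed
  have "integral\<^sup>L lebesgue (\<lambda>x. f x * (\<theta> \<bullet> x - \<theta> \<bullet> ?\<mu>)\<^sup>2) =
      (\<Sum>i\<in>UNIV. \<Sum>j\<in>UNIV. (\<theta> $ i * \<theta> $ j) * covariance_matrix f $ i $ j)"
    unfolding eq using i by (simp add: covariance_matrix_def)
  also have "\<dots> = \<theta> \<bullet> (covariance_matrix f *v \<theta>)"
    by (simp add: inner_vec_def matrix_vector_mult_def sum_distrib_left mult_ac)
  finally show ?thesis by simp
qed

section \<open>Tail functions and the shift-invariance bound\<close>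

lemma tail_function_min_exp:
  assumes "0 < a" "0 \<le> b"
  shows "tail_function (\<lambda>t. min 1 (b * exp (- a * t)))"
  unfolding tail_function_def
proof (intro conjI allI impI)
  show "antimono_on {0<..} (\<lambda>t. min 1 (b * exp (- a * t)))"
    using assms by (intro monotone_onI min.mono mult_left_mono) auto
  have "filterlim (\<lambda>t. - a * t) at_bot at_top"
    using assms by (intro filterlim_tendsto_neg_mult_at_bot[OF tendsto_const]) (auto simp: filterlim_ident)
  then have "((\<lambda>t. b * exp (- a * t)) \<longlongrightarrow> b * 0) at_top"
    by (intro tendsto_mult tendsto_const filterlim_compose[OF exp_at_bot])
  then have lim: "((\<lambda>t. b * exp (- a * t)) \<longlongrightarrow> 0) at_top"
    by simp
  show "((\<lambda>t. min 1 (b * exp (- a * t))) \<longlongrightarrow> 0) at_top"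
    by (rule real_tendsto_sandwich[OF _ _ tendsto_const lim]) (use assms in \<open>simp_all add: always_eventually\<close>)
qed (use assms in auto)

lemma SI_le:
  fixes f :: "real^'n \<Rightarrow> real"
  assumes "0 < \<kappa>" and bound: "\<And>v k. norm v = 1 \<Longrightarrow> 0 \<le> k \<Longrightarrow>
      integral\<^sup>L lebesgue (\<lambda>x. \<bar>f (x + k *\<^sub>R v) - f x\<bar>) \<le> c * k"
  shows "SI f \<kappa> \<le> ereal c"
  unfolding SI_def
proof (rule SUP_least)
  fix v :: "real^'n" assume "v \<in> {v. norm v = 1}"
  then have v: "norm v = 1" by simp
  \<comment> \<open>The assumed bound at \<open>k = 1\<close> shows \<open>c \<ge> 0\<close>, which
    makes \<open>c * k\<close> monotone in \<open>k\<close>.\<close>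
  have "0 \<le> integral\<^sup>L lebesgue (\<lambda>x. \<bar>f (x + 1 *\<^sub>R v) - f x\<bar>)"
    by (intro integral_nonneg_AE) auto
  also have "\<dots> \<le> c * 1"
    by (rule bound[OF v]) simp
  finally have c: "0 \<le> c" by simp
  have "(SUP k\<in>{0..\<kappa>}. ereal (integral\<^sup>L lebesgue (\<lambda>x. \<bar>f (x + k *\<^sub>R v) - f x\<bar>))) \<le> ereal (c * \<kappa>)"
  proof (rule SUP_least)
    fix k assume k: "k \<in> {0..\<kappa>}"
    then have "integral\<^sup>L lebesgue (\<lambda>x. \<bar>f (x + k *\<^sub>R v) - f x\<bar>) \<le> c * k"
      by (intro bound v) simp
    also have "\<dots> \<le> c * \<kappa>"
      using k c by (intro mult_left_mono) auto
    finally show "ereal (integral\<^sup>L lebesgue (\<lambda>x. \<bar>f (x + k *\<^sub>R v) - f x\<bar>)) \<le> ereal (c * \<kappa>)"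
      by simp
  qed
  then have "SI_dir f v \<kappa> \<le> ereal (1 / \<kappa>) * ereal (c * \<kappa>)"
    unfolding SI_dir_def using assms(1) by (intro ereal_mult_left_mono) auto
  then show "SI_dir f v \<kappa> \<le> ereal c"
    using assms(1) by simp
qed

section \<open>Choice of the constants and conclusion\<close>

theorem theorem6:
  fixes C :: real
  shows "\<exists>(c1::real) (g::real \<Rightarrow> real) (a::real) (b::real).
           a > 0 \<and> tail_function g \<and> (\<forall>t>0. g t \<le> b * exp (- a * t)) \<and>
           (\<forall>f :: real^'n \<Rightarrow> real. is_density f \<and> log_concave f \<and> nearly_isotropic C f
              \<longrightarrow> f \<in> C_SI_tail c1 g)"
proof -
  define n where "n = real CARD('n)"
  define vol where "vol = (\<lambda>\<rho>. measure lborel (cball (0::real^'n) \<rho>))"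
  \<comment> \<open>The bound of \<open>first_moment_lower_bound\<close> for
    \<open>T = 1 / (9 * sqrt C)\<close>: then \<open>72 * T ^ 2 = 72 / 81 * (1 / C)\<close> is below
    every directional variance.\<close>
  define c where "c = 1 / (9 * sqrt C) / (144 * 4 ^ CARD('n))"
  \<comment> \<open>This gives \<open>C * n / R ^ 2 = c ^ 2 / (64 * C)\<close>, half of what
    \<open>superlevel_ball\<close> allows; \<open>m\<close> is then chosen to meet its other
    condition with equality.\<close>
  define R where "R = sqrt (64 * C * C * n) / c"
  define m where "m = c\<^sup>2 / (32 * C) / vol R"
  define r where "r = c / 4"
  define M where "M = 1 / (m * (vol (r / 2))\<^sup>2)"
  define S where "S = n * C"
  \<comment> \<open>With \<open>q\<close> for the quotient, \<open>\<rho> - r = 1 + q\<close>, and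
    \<open>q < (1 + q) ^ 2\<close> is the condition of \<open>decay_radius\<close>.\<close>
  define \<rho> where "\<rho> = r + (1 + 4 * S * exp 1 / (m * vol (r / 2)))"
  define c1 where "c1 = 2 / r * (n + ln (M / m))"
  \<comment> \<open>The value 1 keeps \<open>a > 0\<close> when \<open>C \<le> 0\<close>, a case in
    which no density qualifies.\<close>
  define a where "a = (if C > 0 then 1 / (2 * \<rho>) else 1)"
  define b where "b = exp 1 * (2 * n) ^ CARD('n)"
  define g where "g = (\<lambda>t. min 1 (b * exp (- a * t)))"
  have n: "n > 0" by (simp add: n_def)
  have pos: "0 < c" "0 < R" "0 < m" "0 < r" "0 < vol R" "0 < vol (r / 2)" "0 < S" "r + 1 < \<rho>" if "C > 0"
  proof -
    show c: "0 < c" using that by (simp add: c_def)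
    show R: "0 < R" using that n c by (simp add: R_def)
    show v: "0 < vol R" using R by (simp add: vol_def)
    show m: "0 < m" using that c v by (simp add: m_def)
    show r: "0 < r" using c by (simp add: r_def)
    show v': "0 < vol (r / 2)" using r by (simp add: vol_def)
    show S: "0 < S" using that n by (simp add: S_def)
    show "r + 1 < \<rho>" using S m v' by (simp add: \<rho>_def)
  qed
  have a: "a > 0"
  proof (cases "C > 0")
    case True
    have "0 < \<rho>"
      using pos(4,8)[OF True] by linarith
    then show ?thesis by (simp add: a_def)
  qed (simp add: a_def)
  have b: "b \<ge> 0" using n by (simp add: b_def)
  have "f \<in> C_SI_tail c1 g" if f: "is_density f" "log_concave f" "nearly_isotropic C f" for f :: "real^'n \<Rightarrow> real"
  proof -
    have lcd: "log_concave_density2 f"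
      using isotropic_log_concave_density2[OF f] .
    interpret log_concave_density2 f by fact
    define \<mu> where "\<mu> = density_mean f"
    define V where "V = (\<lambda>\<theta>. integral\<^sup>L lebesgue (\<lambda>x. f x * (\<theta> \<bullet> x - \<theta> \<bullet> \<mu>)\<^sup>2))"
    have mean: "integral\<^sup>L lebesgue (\<lambda>x. f x * (\<theta> \<bullet> x - \<theta> \<bullet> \<mu>)) = 0" for \<theta>
      unfolding \<mu>_def by (rule density_mean_centered[OF lcd])
    have V: "1 / C \<le> V \<theta>" "V \<theta> \<le> C" if "norm \<theta> = 1" for \<theta>
    proof -
      have "\<theta> \<noteq> 0" "\<theta> \<bullet> \<theta> = 1"
        using that by (auto simp: norm_eq_1)
      then have "1 / C \<le> \<theta> \<bullet> (covariance_matrix f *v \<theta>) \<and> \<theta> \<bullet> (covariance_matrix f *v \<theta>) \<le> C"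
        using f(3) unfolding nearly_isotropic_def by (metis div_by_1)
      then show "1 / C \<le> V \<theta>" "V \<theta> \<le> C"
        by (auto simp: covariance_quadratic_form[OF lcd] V_def \<mu>_def)
    qed
    obtain e :: "real^'n" where e: "norm e = 1"
      using vector_choose_size[of 1] by auto
    \<comment> \<open>A density is not concentrated on a hyperplane, so its variance in direction
      \<open>e\<close> is positive; being at most \<open>C\<close>, it forces
      \<open>C > 0\<close>.\<close>
    have "0 < V e"
      unfolding V_def using e by (intro second_moment_pos) auto
    then have C: "C > 0"
      using V(2)[OF e] by simp
    note pos = pos[OF C]
    have low: "c \<le> integral\<^sup>L lebesgue (\<lambda>x. f x * \<bar>\<theta> \<bullet> x - \<theta> \<bullet> \<mu>\<bar>)" if "norm \<theta> = 1" for \<theta>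
    proof -
      have "72 * (1 / (9 * sqrt C))\<^sup>2 = 72 / 81 * (1 / C)"
        using C by (simp add: power_divide power_mult_distrib)
      also have "\<dots> < 1 / C"
        using C by (simp add: field_simps)
      also have "\<dots> \<le> V \<theta>"
        by (rule V(1)[OF that])
      finally show ?thesis
        using first_moment_lower_bound[of "1 / (9 * sqrt C)" \<theta> "\<theta> \<bullet> \<mu>"] C
        by (simp add: c_def V_def)
    qed
    have R2: "R\<^sup>2 = 64 * C * C * n / c\<^sup>2"
      using C n by (simp add: R_def power_divide)
    have ball: "m \<le> f q" if q: "q \<in> cball \<mu> r" for q
    proof (rule superlevel_ball[OF mean low V(2)[unfolded V_def] pos(1) C pos(2,3)])
      show "C * DIM(real^'n) / R\<^sup>2 < c\<^sup>2 / (32 * C)"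
        unfolding R2 using C n pos(1) by (simp add: n_def field_simps)
      show "m * measure lborel (cball (0::real^'n) R) \<le> c\<^sup>2 / (32 * C)"
        using pos(5) by (simp add: m_def vol_def)
      show "q \<in> cball \<mu> (c / 4)"
        using q by (simp add: r_def)
    qed auto
    have M: "f x \<le> M" for x
      unfolding M_def vol_def by (rule upper_bound_from_ball[OF pos(3,4) ball])
    have SI: "SI f \<kappa> \<le> ereal c1" if "\<kappa> > 0" for \<kappa>
    proof (rule SI_le[OF that])
      fix v :: "real^'n" and k :: real assume "norm v = 1" "0 \<le> k"
      then show "integral\<^sup>L lebesgue (\<lambda>x. \<bar>f (x + k *\<^sub>R v) - f x\<bar>) \<le> c1 * k"
        using translation_difference_bound[OF pos(3,4) ball M] by (simp add: c1_def n_def)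
    qed
    have S: "integral\<^sup>L lebesgue (\<lambda>x. f x * (norm (x - \<mu>))\<^sup>2) \<le> S"
    proof -
      have "(\<Sum>b\<in>Basis. integral\<^sup>L lebesgue (\<lambda>x. f x * (b \<bullet> x - b \<bullet> \<mu>)\<^sup>2)) \<le> DIM(real^'n) * C"
        by (rule sum_bounded_above) (use V(2) in \<open>auto simp: V_def\<close>)
      then show ?thesis
        by (simp add: integral_norm_sq S_def n_def)
    qed
    have decay: "f x < m / exp 1" if "\<rho> \<le> norm (x - \<mu>)" for x
    proof (rule decay_radius[OF pos(3,4) ball S _ _ that])
      show "r < \<rho>" using pos by simp
      define q where "q = 4 * S * exp 1 / (m * vol (r / 2))"
      have q: "q > 0" using pos by (simp add: q_def)
      have "4 * S * exp 1 = q * (m * vol (r / 2))"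
        using pos by (simp add: q_def)
      also have "\<dots> < (1 + q)\<^sup>2 * (m * vol (r / 2))"
        using pos q by (intro mult_strict_right_mono) (auto simp: power2_sum add_pos_pos)
      also have "1 + q = \<rho> - r"
        by (simp add: \<rho>_def q_def)
      finally show "4 * S * exp 1 < (\<rho> - r)\<^sup>2 * m * measure lborel (cball (0::real^'n) (r / 2))"
        by (simp add: vol_def mult.assoc)
    qed
    have "(LINT x:{x. norm (x - \<mu>) > t}|lebesgue. f x) \<le> g t" if "t > 0" for t
    proof -
      have "(LINT x:{x. norm (x - \<mu>) > t}|lebesgue. f x)
          = integral\<^sup>L lebesgue (\<lambda>x. f x * indicator {x. norm (x - \<mu>) > t} x)"
        by (simp add: set_lebesgue_integral_def mult.commute)
      moreover have "\<dots> \<le> b * exp (- a * t)"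
        using exponential_tail[OF pos(3) ball decay _ that] pos C
        by (simp add: a_def b_def n_def)
      moreover note tail_mass_le_one[where \<mu> = \<mu> and t = t]
      ultimately show ?thesis
        by (simp add: g_def)
    qed
    then show ?thesis
      using f(1) SI by (simp add: C_SI_tail_def C_SI_def \<mu>_def)
  qed
  then have members: "\<forall>f :: real^'n \<Rightarrow> real. is_density f \<and> log_concave f \<and> nearly_isotropic C f
      \<longrightarrow> f \<in> C_SI_tail c1 g"
    by simp
  have tail: "tail_function g"
    unfolding g_def by (rule tail_function_min_exp[OF a b])
  have bound: "\<forall>t>0. g t \<le> b * exp (- a * t)"
    by (simp add: g_def)
  show ?thesis
    by (rule exI[of _ c1], rule exI[of _ g], rule exI[of _ a], rule exI[of _ b])
      (intro conjI a tail bound members)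
qed

end
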